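(* Consider a path of type $COC$ of length $t_f=(\beta+2\pi)/a$, whose circular pieces all have radius $1/a$, whose two $C$ arcs have the same orientation and lie on the same circle, and such that the circular arc from its initial point $z_0$ to its final point $z_f$ formed by these two $C$ arcs together (i.e. the path with its loop $O$ removed) is a non-closed arc subtending the angle $\beta$. Such a path can be optimal (i.e. a solution of Problem (P) for its own endpoints, endpoint velocities and length) only if $\beta\le\frac{\pi}{2}$.
   Context: Problem (P): given $z_0,z_f\in\mathbb R^2$, unit vectors $v_0,v_f\in\mathbb R^2$, and $t_f>0$, minimize $\operatorname{ess\,max}_{t\in[0,t_f]}\|\ddot z(t)\|$ over curves $z\in W^{2,\infty}((0,t_f),\mathbb R^2)$ with $z(0)=z_0$, $z(t_f)=z_f$, $\dot z(0)=v_0$, $\dot z(t_f)=v_f$ and $\|\dot z(t)\|=1$ for a.e. $t$. $C$ denotes a circular arc which is not closed (turning angle strictly between $0$ and $2\pi$) and $O$ a full circle (loop) covered exactly once. A path of type $COC$ is a unit-speed $C^1$ path that is a concatenation of such pieces in the given order; the loop $O$ is tangent to the $C$ arcs at the point where it is attached. *)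

theory Defs
  imports "HOL-Analysis.Analysis" "HOL-Probability.Essential_Supremum"
begin

section \<open>The space W^{2,inf}((0,T), R^2)\<close>

definition ess_sup_norm :: "real set \<Rightarrow> (real \<Rightarrow> real^2) \<Rightarrow> ereal" where
  "ess_sup_norm I f = esssup (lebesgue_on I) (\<lambda>t. ereal (norm (f t)))"

definition Linf :: "real set \<Rightarrow> (real \<Rightarrow> real^2) set" where
  "Linf I = {f. f \<in> borel_measurable (lebesgue_on I) \<and> ess_sup_norm I f < \<infinity>}"

definition test_function :: "real set \<Rightarrow> (real \<Rightarrow> real) \<Rightarrow> bool" where
  "test_function I \<phi> \<longleftrightarrow> \<phi> C1_differentiable_on UNIV \<and>
     (\<exists>K. compact K \<and> K \<subseteq> I \<and> (\<forall>t. t \<notin> K \<longrightarrow> \<phi> t = 0))"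

text \<open>The usual definition of Sobolev spaces on an interval, with compactly supported
  C^1 test functions (as in Brezis; testing with smooth functions gives the same notion).\<close>

definition weak_derivative :: "real set \<Rightarrow> (real \<Rightarrow> real^2) \<Rightarrow> (real \<Rightarrow> real^2) \<Rightarrow> bool" where
  "weak_derivative I f g \<longleftrightarrow> (\<forall>\<phi>. test_function I \<phi> \<longrightarrow>
     (LINT t|lebesgue_on I. deriv \<phi> t *\<^sub>R f t) = - (LINT t|lebesgue_on I. \<phi> t *\<^sub>R g t))"

text \<open>The function \<open>z\<close> represents an element of W^{2,inf}((0,T)) with first and second weak
  derivatives \<open>v\<close> and \<open>u\<close>. Each class in W^{2,inf} has a unique representative that extends
  continuously to [0,T] together with its first derivative; \<open>z\<close> and \<open>v\<close> are required to be
  these representatives, so that their values at 0 and T are the boundary values.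
  The weak derivative \<open>u\<close> is determined by \<open>z\<close> up to a null set.\<close>

definition W2inf_curve ::
  "real \<Rightarrow> (real \<Rightarrow> real^2) \<Rightarrow> (real \<Rightarrow> real^2) \<Rightarrow> (real \<Rightarrow> real^2) \<Rightarrow> bool" where
  "W2inf_curve T z v u \<longleftrightarrow>
     z \<in> Linf {0<..<T} \<and> v \<in> Linf {0<..<T} \<and> u \<in> Linf {0<..<T} \<and>
     weak_derivative {0<..<T} z v \<and> weak_derivative {0<..<T} v u \<and>
     continuous_on {0..T} z \<and> continuous_on {0..T} v"


section \<open>Problem (P)\<close>

definition admissible ::
  "real^2 \<Rightarrow> real^2 \<Rightarrow> real^2 \<Rightarrow> real^2 \<Rightarrow> real \<Rightarrow>
   (real \<Rightarrow> real^2) \<Rightarrow> (real \<Rightarrow> real^2) \<Rightarrow> (real \<Rightarrow> real^2) \<Rightarrow> bool" where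
  "admissible z0 zf v0 vf T z v u \<longleftrightarrow>
     W2inf_curve T z v u \<and>
     z 0 = z0 \<and> z T = zf \<and> v 0 = v0 \<and> v T = vf \<and>
     (AE t in lebesgue_on {0<..<T}. norm (v t) = 1)"

definition solves_P ::
  "real^2 \<Rightarrow> real^2 \<Rightarrow> real^2 \<Rightarrow> real^2 \<Rightarrow> real \<Rightarrow> (real \<Rightarrow> real^2) \<Rightarrow> bool" where
  "solves_P z0 zf v0 vf T z \<longleftrightarrow>
     (\<exists>v u. admissible z0 zf v0 vf T z v u \<and>
        (\<forall>z' v' u'. admissible z0 zf v0 vf T z' v' u' \<longrightarrow>
           ess_sup_norm {0<..<T} u \<le> ess_sup_norm {0<..<T} u'))"


section \<open>Paths of type COC\<close>

definition unit_speed_C1 :: "real \<Rightarrow> (real \<Rightarrow> real^2) \<Rightarrow> (real \<Rightarrow> real^2) \<Rightarrow> bool" where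
  "unit_speed_C1 T z v \<longleftrightarrow>
     (\<forall>t\<in>{0..T}. (z has_vector_derivative v t) (at t within {0..T}) \<and> norm (v t) = 1) \<and>
     continuous_on {0..T} v"

text \<open>On [s,t] the curve \<open>z\<close> runs with unit speed along the circle with radius \<open>r\<close> and centre
  \<open>c\<close>, turning through the angle \<open>\<psi>\<close>; it is oriented counterclockwise if \<open>\<sigma> = 1\<close> and
  clockwise if \<open>\<sigma> = -1\<close>.\<close>

definition circular_piece ::
  "real \<Rightarrow> real \<Rightarrow> real^2 \<Rightarrow> real \<Rightarrow> (real \<Rightarrow> real^2) \<Rightarrow> real \<Rightarrow> real \<Rightarrow> bool" where
  "circular_piece r \<sigma> c \<psi> z s t \<longleftrightarrow>
     0 < r \<and> (\<sigma> = 1 \<or> \<sigma> = -1) \<and> s < t \<and> \<psi> = (t - s) / r \<and>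
     (\<exists>\<theta>. \<forall>\<tau>\<in>{s..t}. z \<tau> = c + r *\<^sub>R vector [cos (\<theta> + \<sigma> * (\<tau> - s) / r), sin (\<theta> + \<sigma> * (\<tau> - s) / r)])"

definition C_piece ::
  "real \<Rightarrow> real \<Rightarrow> real^2 \<Rightarrow> real \<Rightarrow> (real \<Rightarrow> real^2) \<Rightarrow> real \<Rightarrow> real \<Rightarrow> bool" where
  "C_piece r \<sigma> c \<psi> z s t \<longleftrightarrow> circular_piece r \<sigma> c \<psi> z s t \<and> 0 < \<psi> \<and> \<psi> < 2 * pi"

definition O_piece ::
  "real \<Rightarrow> real \<Rightarrow> real^2 \<Rightarrow> (real \<Rightarrow> real^2) \<Rightarrow> real \<Rightarrow> real \<Rightarrow> bool" where
  "O_piece r \<sigma> c z s t \<longleftrightarrow> circular_piece r \<sigma> c (2 * pi) z s t"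

text \<open>The loop is traversed during [t1,t2]. Its tangency to the \<open>C\<close> arcs is the
  differentiability at t1 and t2; it may be attached on either side of the arcs.\<close>

definition COC_path ::
  "real \<Rightarrow> real \<Rightarrow> (real \<Rightarrow> real^2) \<Rightarrow> (real \<Rightarrow> real^2) \<Rightarrow> real \<Rightarrow> real \<Rightarrow>
   real \<Rightarrow> real^2 \<Rightarrow> real \<Rightarrow> real^2 \<Rightarrow> real \<Rightarrow> real^2 \<Rightarrow> bool" where
  "COC_path r T z v t1 t2 \<sigma>1 c1 \<sigma>2 c2 \<sigma>3 c3 \<longleftrightarrow>
     unit_speed_C1 T z v \<and>
     (\<exists>\<psi>. C_piece r \<sigma>1 c1 \<psi> z 0 t1) \<and>
     O_piece r \<sigma>2 c2 z t1 t2 \<and>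
     (\<exists>\<psi>. C_piece r \<sigma>3 c3 \<psi> z t2 T)"

definition remove_loop :: "real \<Rightarrow> real \<Rightarrow> (real \<Rightarrow> real^2) \<Rightarrow> real \<Rightarrow> real^2" where
  "remove_loop t1 t2 z t = (if t \<le> t1 then z t else z (t + (t2 - t1)))"

end

theory Submission
  imports Defs
begin

text \<open>A circle of radius \<open>1 / a\<close> has acceleration \<open>a\<close>, so the path is not optimal as soon as some admissible
curve stays below a constant \<open>K < a\<close>. Such a curve exists whenever \<open>\<beta> > \<pi> / 2\<close>.

Put \<open>b = \<beta> / 2\<close> and look for a competitor that is symmetric about the bisector of the arc. It is
described by the angle \<open>\<Theta>\<close> from its velocity to the direction of the chord; \<open>\<Theta>\<close> runs from \<open>b\<close> to
\<open>-b\<close> and is odd about the midpoint of the time interval, whose half is \<open>h = (b + \<pi>) / a\<close>. The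
symmetry settles all boundary conditions except one: the chord must have the right length, that
is, \<open>\<integral> cos \<Theta> = sin b / a\<close> over the first half. Consider the angles
\<open>min (b + j s) (K (h - s))\<close>, which start with slope \<open>j\<close> and come down to \<open>0\<close> with slope \<open>-K\<close>. For
\<open>j = -b / h\<close> the descent is linear and the chord is too long. For \<open>j = K\<close> the curve first turns
away from the arc and then back, and at the limit value \<open>K = a\<close> the integral is
\<open>(2 cos b - sin b) / a\<close>, which is too short exactly because \<open>cos b < sin b\<close> for \<open>b > \<pi> / 4\<close>.
This inequality is strict, so it survives for some \<open>K < a\<close>, and the intermediate value
theorem gives a \<open>j\<close> with the right chord (\<open>slopes_for_prescribed_chord\<close>,
\<open>admissible_competitor\<close>).

On the other hand, every weak second derivative of a curve that begins with an arc of radius \<open>1 / a\<close> has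
essential supremum at least \<open>a\<close> (\<open>curvature_bound_of_circular_start\<close>). To see this, two integrations
by parts against a bump supported in the time interval of the arc replace it by the classical
acceleration of the circle.\<close>

section \<open>Weak derivatives and essential suprema\<close>

lemma finite_measure_lebesgue_on_Ioo: "finite_measure (lebesgue_on {s<..<t::real})"
  by (rule finite_measure_lebesgue_on) (simp add: lmeasurable_interval flip: box_real)

lemma integrable_lebesgue_on_Ioo_bounded:
  fixes f :: "real \<Rightarrow> 'b::{banach, second_countable_topology}"
  assumes "f \<in> borel_measurable (lebesgue_on {s<..<t})"
    and "\<And>x. x \<in> {s<..<t} \<Longrightarrow> norm (f x) \<le> B"
  shows "integrable (lebesgue_on {s<..<t}) f"
  using assms
  by (intro finite_measure.integrable_const_bound[OF finite_measure_lebesgue_on_Ioo, where B = B] AE_I2) auto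

lemma borel_measurable_lebesgue_on_Ioo:
  fixes f :: "real \<Rightarrow> 'b::euclidean_space"
  assumes "continuous_on {s..t} f"
  shows "f \<in> borel_measurable (lebesgue_on {s<..<t})"
  by (rule continuous_imp_measurable_on_sets_lebesgue[OF continuous_on_subset[OF assms]]) auto

lemma continuous_on_Icc_bounded:
  fixes f :: "real \<Rightarrow> 'b::euclidean_space"
  assumes "continuous_on {s..t} f"
  obtains B where "\<And>x. x \<in> {s..t} \<Longrightarrow> norm (f x) \<le> B"
  using compact_imp_bounded[OF compact_continuous_image[OF assms compact_Icc]] that
  unfolding bounded_iff by blast

text \<open>Kinks at finitely many points do not disturb the fundamental theorem of calculus, so integration
by parts over the whole interval produces no jump terms as long as \<open>f\<close> itself is continuous.\<close>

lemma weak_derivative_of_piecewise: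
  fixes f g :: "real \<Rightarrow> real^2"
  assumes T: "0 < T" and f: "continuous_on {0..T} f" and S: "finite S"
    and der: "\<And>t. t \<in> {0<..<T} - S \<Longrightarrow> (f has_vector_derivative g t) (at t)"
    and gm: "g \<in> borel_measurable (lebesgue_on {0<..<T})"
    and gB: "\<And>t. t \<in> {0<..<T} \<Longrightarrow> norm (g t) \<le> B"
  shows "weak_derivative {0<..<T} f g"
  unfolding weak_derivative_def
proof (intro allI impI)
  fix \<phi> assume "test_function {0<..<T} \<phi>"
  then obtain K where C1: "\<phi> C1_differentiable_on UNIV" and K: "K \<subseteq> {0<..<T}"
    and supp: "\<And>t. t \<notin> K \<Longrightarrow> \<phi> t = 0"
    unfolding test_function_def by blast
  have vd: "vector_derivative \<phi> (at x) = deriv \<phi> x" for x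
    by (simp add: field_derivative_eq_vector_derivative)
  have d: "(\<phi> has_real_derivative deriv \<phi> t) (at t)" for t
    using C1 by (simp add: C1_differentiable_on_eq DERIV_deriv_iff_real_differentiable)
  have c1: "continuous_on UNIV (deriv \<phi>)"
    using C1 by (simp add: C1_differentiable_on_eq vd)
  have c0: "continuous_on UNIV \<phi>"
    using C1 C1_differentiable_imp_continuous_on by blast
  have "0 \<notin> K" "T \<notin> K" using K by auto
  then have [simp]: "\<phi> 0 = 0" "\<phi> T = 0" using supp by auto
  let ?I = "{0<..<T}"
  obtain B1 where B1: "\<And>t. t \<in> {0..T} \<Longrightarrow> norm (\<phi> t) \<le> B1"
    using continuous_on_Icc_bounded continuous_on_subset[OF c0] by blast
  have i1: "integrable (lebesgue_on ?I) (\<lambda>t. \<phi> t *\<^sub>R g t)"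
  proof (rule integrable_lebesgue_on_Ioo_bounded[where B = "B1 * B"])
    show "(\<lambda>t. \<phi> t *\<^sub>R g t) \<in> borel_measurable (lebesgue_on ?I)"
      by (intro borel_measurable_scaleR gm borel_measurable_lebesgue_on_Ioo continuous_on_subset[OF c0]) auto
    show "norm (\<phi> t *\<^sub>R g t) \<le> B1 * B" if "t \<in> ?I" for t
      using B1[of t] gB[OF that] that by (auto intro!: mult_mono order_trans[OF _ B1[of t]])
  qed
  have c2: "continuous_on {0..T} (\<lambda>t. deriv \<phi> t *\<^sub>R f t)"
    by (intro continuous_intros f continuous_on_subset[OF c1]) auto
  obtain B2 where B2: "\<And>t. t \<in> {0..T} \<Longrightarrow> norm (deriv \<phi> t *\<^sub>R f t) \<le> B2"
    using continuous_on_Icc_bounded[OF c2] by blast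
  have i2: "integrable (lebesgue_on ?I) (\<lambda>t. deriv \<phi> t *\<^sub>R f t)"
    by (rule integrable_lebesgue_on_Ioo_bounded[OF borel_measurable_lebesgue_on_Ioo[OF c2], where B = B2]) (use B2 in auto)
  have "((\<lambda>t. \<phi> t *\<^sub>R g t + deriv \<phi> t *\<^sub>R f t) has_integral (\<phi> T *\<^sub>R f T - \<phi> 0 *\<^sub>R f 0)) {0..T}"
  proof (rule fundamental_theorem_of_calculus_interior_strong[OF S])
    show "continuous_on {0..T} (\<lambda>t. \<phi> t *\<^sub>R f t)"
      by (intro continuous_intros f continuous_on_subset[OF c0]) auto
    show "((\<lambda>t. \<phi> t *\<^sub>R f t) has_vector_derivative \<phi> t *\<^sub>R g t + deriv \<phi> t *\<^sub>R f t) (at t)"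
      if "t \<in> {0<..<T} - S" for t
      by (rule has_vector_derivative_scaleR[OF d der[OF that]])
  qed (use T in auto)
  then have "((\<lambda>t. \<phi> t *\<^sub>R g t + deriv \<phi> t *\<^sub>R f t) has_integral 0) ?I"
    by (simp add: has_integral_Icc_iff_Ioo)
  moreover have "((\<lambda>t. \<phi> t *\<^sub>R g t + deriv \<phi> t *\<^sub>R f t) has_integral
      (LINT t|lebesgue_on ?I. \<phi> t *\<^sub>R g t + deriv \<phi> t *\<^sub>R f t)) ?I"
    by (intro has_integral_integral_lebesgue_on Bochner_Integration.integrable_add i1 i2) auto
  ultimately have "(LINT t|lebesgue_on ?I. \<phi> t *\<^sub>R g t + deriv \<phi> t *\<^sub>R f t) = 0"
    by (rule has_integral_unique[rotated])
  then show "(LINT t|lebesgue_on ?I. deriv \<phi> t *\<^sub>R f t) = - (LINT t|lebesgue_on ?I. \<phi> t *\<^sub>R g t)"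
    by (simp add: Bochner_Integration.integral_add[OF i1 i2] eq_neg_iff_add_eq_0 add.commute)
qed

lemma ess_sup_norm_le_iff:
  assumes "f \<in> borel_measurable (lebesgue_on I)"
  shows "ess_sup_norm I f \<le> ereal B \<longleftrightarrow> (AE t in lebesgue_on I. norm (f t) \<le> B)"
proof
  assume "ess_sup_norm I f \<le> ereal B"
  then have le: "esssup (lebesgue_on I) (\<lambda>t. ereal (norm (f t))) \<le> ereal B"
    unfolding ess_sup_norm_def .
  show "AE t in lebesgue_on I. norm (f t) \<le> B"
    using esssup_AE[of "\<lambda>t. ereal (norm (f t))" "lebesgue_on I"]
  proof eventually_elim
    case (elim t)
    then have "ereal (norm (f t)) \<le> ereal B" using le by (rule order_trans)
    then show ?case by simp
  qed
next
  assume "AE t in lebesgue_on I. norm (f t) \<le> B"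
  then show "ess_sup_norm I f \<le> ereal B"
    unfolding ess_sup_norm_def using assms by (intro esssup_I) auto
qed

lemma Linf_of_bounded:
  assumes "f \<in> borel_measurable (lebesgue_on {s<..<t})" "\<And>x. x \<in> {s<..<t} \<Longrightarrow> norm (f x) \<le> B"
  shows "f \<in> Linf {s<..<t}"
proof -
  have "ess_sup_norm {s<..<t} f \<le> ereal B"
    by (subst ess_sup_norm_le_iff) (use assms in \<open>auto intro!: AE_I2\<close>)
  then show ?thesis using assms(1) by (auto simp: Linf_def)
qed

section \<open>The rotating frame\<close>

text \<open>Parametrised by the polar angle, these are the radial and the tangential unit vector of a
counterclockwise circle.\<close>

definition direction :: "real \<Rightarrow> real^2" where
  "direction t = vector [cos t, sin t]"

definition normal :: "real \<Rightarrow> real^2" where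
  "normal t = vector [- sin t, cos t]"

lemma vector_2_eq: "(vector [x, y] :: real^2) = x *\<^sub>R axis 1 1 + y *\<^sub>R axis 2 1"
  by (simp add: vec_eq_iff forall_2 axis_def)

lemma direction_vector_derivative:
  assumes "(g has_real_derivative g') (at t within S)"
  shows "((\<lambda>t. direction (g t)) has_vector_derivative g' *\<^sub>R normal (g t)) (at t within S)"
  unfolding direction_def normal_def vector_2_eq
  using assms by (auto intro!: derivative_eq_intros simp: algebra_simps)

lemma normal_vector_derivative:
  assumes "(g has_real_derivative g') (at t within S)"
  shows "((\<lambda>t. normal (g t)) has_vector_derivative - g' *\<^sub>R direction (g t)) (at t within S)"
  unfolding direction_def normal_def vector_2_eq
  using assms by (auto intro!: derivative_eq_intros simp: algebra_simps)

lemma continuous_on_direction: "continuous_on S (g :: real \<Rightarrow> real) \<Longrightarrow> continuous_on S (\<lambda>t. direction (g t))"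
  unfolding direction_def vector_2_eq by (intro continuous_intros)

lemma continuous_on_normal: "continuous_on S (g :: real \<Rightarrow> real) \<Longrightarrow> continuous_on S (\<lambda>t. normal (g t))"
  unfolding normal_def vector_2_eq by (intro continuous_intros)

lemma inner_direction: "direction s \<bullet> direction t = cos (s - t)"
  by (simp add: direction_def inner_vec_def sum_2 cos_diff)

lemma norm_direction [simp]: "norm (direction t) = 1"
  by (simp add: norm_eq_sqrt_inner inner_direction)

lemma norm_normal [simp]: "norm (normal t) = 1"
  by (simp add: norm_eq_sqrt_inner normal_def inner_vec_def sum_2 flip: power2_eq_square)

lemma direction_add: "direction (s + t) = cos t *\<^sub>R direction s + sin t *\<^sub>R normal s"
  by (simp add: direction_def normal_def vec_eq_iff forall_2 cos_add sin_add)

lemma normal_add: "normal (s + t) = cos t *\<^sub>R normal s - sin t *\<^sub>R direction s"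
  by (simp add: direction_def normal_def vec_eq_iff forall_2 cos_add sin_add)

section \<open>The acceleration of a circular arc, tested weakly\<close>

lemma test_functionI:
  assumes "\<And>x. (\<phi> has_real_derivative D x) (at x)" "continuous_on UNIV D"
    and "{s..t} \<subseteq> I" "\<And>x. x \<notin> {s..t} \<Longrightarrow> \<phi> x = 0"
  shows "test_function I \<phi>"
  unfolding test_function_def C1_differentiable_on_def
  using assms by (auto simp: has_real_derivative_iff_has_vector_derivative intro!: exI[of _ "{s..t}"])

text \<open>Powers of the positive part join zero smoothly: this makes the cubed bump below twice continuously
differentiable, while each further derivative costs one power.\<close>

lemma pos_part_power_derivative:
  "((\<lambda>x. max 0 x ^ Suc (Suc n)) has_real_derivative real (Suc (Suc n)) * max 0 x ^ Suc n) (at (x::real))"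
proof -
  consider "x < 0" | "x > 0" | "x = 0" by linarith
  then show ?thesis
  proof cases
    case 1
    have "((\<lambda>x::real. 0) has_real_derivative 0) (at x)" by simp
    then have "((\<lambda>x. max 0 x ^ Suc (Suc n)) has_real_derivative 0) (at x)"
      by (rule has_field_derivative_transform_within_open[of _ _ _ "{..<0}"]) (use 1 in auto)
    then show ?thesis using 1 by simp
  next
    case 2
    have "((\<lambda>x. x ^ Suc (Suc n)) has_real_derivative real (Suc (Suc n)) * x ^ Suc n) (at x)"
      using DERIV_pow[of "Suc (Suc n)" x UNIV] by simp
    then have "((\<lambda>x. max 0 x ^ Suc (Suc n)) has_real_derivative real (Suc (Suc n)) * x ^ Suc n) (at x)"
      by (rule has_field_derivative_transform_within_open[of _ _ _ "{0<..}"]) (use 2 in auto)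
    then show ?thesis using 2 by simp
  next
    case 3
    have le: "norm (max 0 h ^ Suc (Suc n) / h) \<le> \<bar>h\<bar> ^ Suc n" for h :: real
    proof (cases "h > 0")
      case True
      then show ?thesis by (auto simp: max_def)
    next
      case False
      then have "max 0 h = 0" by linarith
      then show ?thesis by (simp only: power_0_Suc div_0 norm_zero zero_le_power_abs)
    qed
    have "((\<lambda>h::real. \<bar>h\<bar> ^ Suc n) \<longlongrightarrow> \<bar>0\<bar> ^ Suc n) (at 0)"
      by (intro tendsto_intros)
    then have lim: "((\<lambda>h::real. \<bar>h\<bar> ^ Suc n) \<longlongrightarrow> 0) (at 0)"
      by simp
    have "((\<lambda>h::real. max 0 h ^ Suc (Suc n) / h) \<longlongrightarrow> 0) (at 0)"
      by (rule Lim_null_comparison[OF always_eventually[OF allI[OF le]] lim])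
    then show ?thesis unfolding 3 DERIV_def by (simp only: add_0 max.idem power_0_Suc diff_0_right mult_zero_right)
  qed
qed

text \<open>The bump \<open>max 0 (\<delta>\<^sup>2 - (t - m)\<^sup>2)\<^sup>3\<close>; both it and its derivative are then admissible as
test functions of class \<open>C\<^sup>1\<close>, so that one can integrate by parts twice.\<close>

lemma C2_bump:
  fixes m \<delta> :: real
  assumes "0 < \<delta>"
  obtains \<phi> \<phi>' \<phi>'' where "\<And>t. (\<phi> has_real_derivative \<phi>' t) (at t)"
    "\<And>t. (\<phi>' has_real_derivative \<phi>'' t) (at t)" "continuous_on UNIV \<phi>''"
    "\<And>t. 0 \<le> \<phi> t" "0 < \<phi> m" "\<And>t. t \<notin> {m - \<delta>..m + \<delta>} \<Longrightarrow> \<phi> t = 0 \<and> \<phi>' t = 0 \<and> \<phi>'' t = 0"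
proof -
  define p where "p t = \<delta>\<^sup>2 - (t - m)\<^sup>2" for t
  define \<phi> where "\<phi> t = max 0 (p t) ^ 3" for t
  define \<phi>' where "\<phi>' t = 3 * max 0 (p t) ^ 2 * (- 2 * (t - m))" for t
  define \<phi>'' where "\<phi>'' t = 3 * (2 * max 0 (p t) * (- 2 * (t - m))) * (- 2 * (t - m)) + 3 * max 0 (p t) ^ 2 * (- 2)" for t
  have dp: "(p has_real_derivative - 2 * (t - m)) (at t)" for t
    unfolding p_def by (auto intro!: derivative_eq_intros)
  have d3: "((\<lambda>t. max 0 (p t) ^ 3) has_real_derivative 3 * max 0 (p t) ^ 2 * (- 2 * (t - m))) (at t)" for t
    using DERIV_chain2[OF pos_part_power_derivative[of 1] dp] by (simp add: eval_nat_numeral)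
  have d2: "((\<lambda>t. max 0 (p t) ^ 2) has_real_derivative 2 * max 0 (p t) * (- 2 * (t - m))) (at t)" for t
    using DERIV_chain2[OF pos_part_power_derivative[of 0] dp] by (simp add: eval_nat_numeral)
  have p0: "p t \<le> 0" if "t \<notin> {m - \<delta>..m + \<delta>}" for t
  proof -
    have "\<bar>\<delta>\<bar> \<le> \<bar>t - m\<bar>" using that assms by auto
    then show ?thesis unfolding p_def by (simp add: abs_le_square_iff)
  qed
  show thesis
  proof (rule that)
    show "(\<phi> has_real_derivative \<phi>' t) (at t)" for t
      unfolding \<phi>_def \<phi>'_def by (rule d3)
    show "(\<phi>' has_real_derivative \<phi>'' t) (at t)" for t
      unfolding \<phi>'_def \<phi>''_def
      using DERIV_mult[OF DERIV_cmult[OF d2, of 3] DERIV_cmult[OF DERIV_diff[OF DERIV_ident DERIV_const[of m]], of "- 2"], of t]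
      by (simp add: algebra_simps)
    show "continuous_on UNIV \<phi>''" unfolding \<phi>''_def p_def by (intro continuous_intros)
    show "0 < \<phi> m" using assms by (simp add: \<phi>_def p_def)
    show "0 \<le> \<phi> t" for t by (simp add: \<phi>_def)
    show "\<phi> t = 0 \<and> \<phi>' t = 0 \<and> \<phi>'' t = 0" if "t \<notin> {m - \<delta>..m + \<delta>}" for t
      using p0[OF that] by (simp add: \<phi>_def \<phi>'_def \<phi>''_def max_absorb1)
  qed
qed

text \<open>Both sides equal the integral of \<open>\<phi>'' *\<^sub>R z\<close>, which sees the curve only on the support of \<open>\<phi>''\<close>.
In this way one passes directly from \<open>z\<close> to \<open>u\<close>, and the weak derivative \<open>v\<close> never has to be
identified with the classical velocity.\<close>

lemma second_weak_derivative_local: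
  assumes "weak_derivative I z v" "weak_derivative I v u"
    and "weak_derivative I Z V" "weak_derivative I V U"
    and \<phi>: "\<And>t. (\<phi> has_real_derivative \<phi>' t) (at t)" and \<phi>': "\<And>t. (\<phi>' has_real_derivative \<phi>'' t) (at t)"
    and "test_function I \<phi>" "test_function I \<phi>'"
    and eq: "\<And>t. t \<in> I \<Longrightarrow> \<phi>'' t \<noteq> 0 \<Longrightarrow> z t = Z t"
  shows "(LINT t|lebesgue_on I. \<phi> t *\<^sub>R u t) = (LINT t|lebesgue_on I. \<phi> t *\<^sub>R U t)"
proof -
  have [simp]: "deriv \<phi> = \<phi>'" "deriv \<phi>' = \<phi>''" using \<phi> \<phi>' by (auto intro!: ext DERIV_imp_deriv)
  have "(LINT t|lebesgue_on I. \<phi>'' t *\<^sub>R z t) = (LINT t|lebesgue_on I. \<phi>'' t *\<^sub>R Z t)"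
    using eq by (intro Bochner_Integration.integral_cong) (auto simp: space_restrict_space)
  moreover have "(LINT t|lebesgue_on I. \<phi>' t *\<^sub>R f t) = - (LINT t|lebesgue_on I. \<phi> t *\<^sub>R g t)"
    "(LINT t|lebesgue_on I. \<phi>'' t *\<^sub>R f t) = - (LINT t|lebesgue_on I. \<phi>' t *\<^sub>R g t)"
    if "weak_derivative I f g" for f g
    using that assms(7,8) unfolding weak_derivative_def by force+
  ultimately show ?thesis using assms(1-4) by simp
qed

lemma circle_vector_derivative:
  assumes "a > 0"
  shows "((\<lambda>t. c + (1 / a) *\<^sub>R direction (\<theta> + \<sigma> * a * (t - \<rho>))) has_vector_derivative
    \<sigma> *\<^sub>R normal (\<theta> + \<sigma> * a * (t - \<rho>))) (at t within S)"
proof -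
  have "((\<lambda>t. \<theta> + \<sigma> * a * (t - \<rho>)) has_real_derivative \<sigma> * a) (at t within S)"
    by (auto intro!: derivative_eq_intros)
  from direction_vector_derivative[OF this] show ?thesis
    using assms by (auto intro!: derivative_eq_intros)
qed

text \<open>Near the time \<open>m\<close> the acceleration of the circle has a component close to \<open>a\<close> in the direction from
the point at time \<open>m\<close> to the centre. If \<open>norm u\<close> were bounded by \<open>K < a\<close>, the average of \<open>u\<close> against a
narrow bump around \<open>m\<close> would have a component of at most \<open>K\<close>, although it equals the average of the
acceleration of the circle.\<close>

lemma curvature_bound_of_circular_start:
  fixes a d T K \<sigma> :: real
  assumes W: "W2inf_curve T z v u" and a: "0 < a" and \<sigma>: "\<sigma> = 1 \<or> \<sigma> = -1" and d: "0 < d" "d \<le> T"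
    and circ: "\<And>t. t \<in> {0..d} \<Longrightarrow> z t = c + (1 / a) *\<^sub>R direction (\<theta> + \<sigma> * a * t)"
    and bound: "AE t in lebesgue_on {0<..<T}. norm (u t) \<le> K"
  shows "a \<le> K"
proof (rule ccontr)
  assume "\<not> a \<le> K"
  then have K: "K < a" by simp
  let ?I = "{0<..<T}" and ?M = "lebesgue_on {0<..<T}"
  define m where "m = d / 2"
  define Z where "Z t = c + (1 / a) *\<^sub>R direction (\<theta> + \<sigma> * a * (t - 0))" for t
  define V where "V t = \<sigma> *\<^sub>R normal (\<theta> + \<sigma> * a * (t - 0))" for t
  define U where "U t = - a *\<^sub>R direction (\<theta> + \<sigma> * a * (t - 0))" for t
  have "((\<lambda>\<delta>. a * cos (a * \<delta>)) \<longlongrightarrow> a * cos (a * 0)) (at_right 0)"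
    by (intro tendsto_intros)
  then have "\<forall>\<^sub>F \<delta> in at_right 0. K < a * cos (a * \<delta>)"
    using K by (intro order_tendstoD(1)) auto
  moreover have "\<forall>\<^sub>F \<delta> in at_right 0. \<delta> \<in> {0<..<min (d / 4) (pi / a)}"
    using a d by (intro eventually_at_right_real) auto
  ultimately have "\<forall>\<^sub>F \<delta> in at_right 0. K < a * cos (a * \<delta>) \<and> \<delta> \<in> {0<..<min (d / 4) (pi / a)}"
    by (rule eventually_conj)
  then obtain \<delta> where \<delta>: "K < a * cos (a * \<delta>)" "0 < \<delta>" "\<delta> < d / 4" "\<delta> < pi / a"
    by (auto dest!: eventually_happens simp: trivial_limit_at_right_real)
  \<comment> \<open>The bump is so narrow that on its support the inward component \<open>a * cos (a * (t - m))\<close> exceeds \<open>K\<close>.\<close>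
  obtain \<phi> \<phi>' \<phi>'' where \<phi>: "\<And>t. (\<phi> has_real_derivative \<phi>' t) (at t)"
    and \<phi>': "\<And>t. (\<phi>' has_real_derivative \<phi>'' t) (at t)" and c2: "continuous_on UNIV \<phi>''"
    and pos: "\<And>t. 0 \<le> \<phi> t" "0 < \<phi> m"
    and supp: "\<And>t. t \<notin> {m - \<delta>..m + \<delta>} \<Longrightarrow> \<phi> t = 0 \<and> \<phi>' t = 0 \<and> \<phi>'' t = 0"
    using C2_bump[OF \<delta>(2), of m] by metis
  have c0: "continuous_on S \<phi>" and c1: "continuous_on S \<phi>'" for S
    by (rule DERIV_continuous_on, rule has_field_derivative_at_within, rule \<phi> \<phi>')+
  have sub: "{m - \<delta>..m + \<delta>} \<subseteq> ?I" using \<delta> d by (auto simp: m_def)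
  have test: "test_function ?I \<phi>" "test_function ?I \<phi>'"
    using supp by (auto intro!: test_functionI[OF \<phi> c1 sub] test_functionI[OF \<phi>' c2 sub])
  have cU: "continuous_on S U" and cV: "continuous_on S V" and cZ: "continuous_on S Z" for S
    unfolding U_def V_def Z_def
    by (intro continuous_intros continuous_on_direction continuous_on_normal)+
  have T: "0 < T" using d by simp
  have wZ: "weak_derivative ?I Z V"
  proof (rule weak_derivative_of_piecewise[OF T cZ finite.emptyI, where B = 1])
    show "(Z has_vector_derivative V t) (at t)" for t
      unfolding Z_def V_def by (rule circle_vector_derivative[OF a])
    show "V \<in> borel_measurable ?M" by (rule borel_measurable_lebesgue_on_Ioo[OF cV])
    show "norm (V t) \<le> 1" for t using \<sigma> by (auto simp: V_def)
  qed
  have wV: "weak_derivative ?I V U"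
  proof (rule weak_derivative_of_piecewise[OF T cV finite.emptyI, where B = a])
    have "((\<lambda>t. \<theta> + \<sigma> * a * (t - 0)) has_real_derivative \<sigma> * a) (at t)" for t
      by (auto intro!: derivative_eq_intros)
    from normal_vector_derivative[OF this]
    show "(V has_vector_derivative U t) (at t)" for t
      unfolding V_def U_def using \<sigma> by (auto intro!: derivative_eq_intros)
    show "U \<in> borel_measurable ?M" by (rule borel_measurable_lebesgue_on_Ioo[OF cU])
    show "norm (U t) \<le> a" for t using a by (auto simp: U_def)
  qed
  have eq: "(LINT t|?M. \<phi> t *\<^sub>R u t) = (LINT t|?M. \<phi> t *\<^sub>R U t)"
  proof (rule second_weak_derivative_local[OF _ _ wZ wV \<phi> \<phi>' test])
    show "weak_derivative ?I z v" "weak_derivative ?I v u" using W by (auto simp: W2inf_curve_def)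
    show "z t = Z t" if "\<phi>'' t \<noteq> 0" for t
    proof -
      have "t \<in> {m - \<delta>..m + \<delta>}" using supp that by blast
      then have "t \<in> {0..d}" using \<delta> by (auto simp: m_def)
      then show ?thesis using circ by (simp add: Z_def)
    qed
  qed
  obtain B where B: "\<And>t. t \<in> {0..T} \<Longrightarrow> norm (\<phi> t) \<le> B"
    using continuous_on_Icc_bounded[OF c0] by blast
  have mphi: "\<phi> \<in> borel_measurable ?M" by (rule borel_measurable_lebesgue_on_Ioo[OF c0])
  have iphi: "integrable ?M \<phi>"
    by (rule integrable_lebesgue_on_Ioo_bounded[OF mphi, of B]) (use B in auto)
  have iu: "integrable ?M (\<lambda>t. \<phi> t *\<^sub>R u t)"
  proof (rule Bochner_Integration.integrable_bound[OF integrable_mult_right[OF iphi, of K]])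
    show "(\<lambda>t. \<phi> t *\<^sub>R u t) \<in> borel_measurable ?M"
      using W by (intro borel_measurable_scaleR mphi) (auto simp: W2inf_curve_def Linf_def)
    show "AE t in ?M. norm (\<phi> t *\<^sub>R u t) \<le> norm (K * \<phi> t)"
      using bound
    proof eventually_elim
      case (elim t)
      then have "\<phi> t * norm (u t) \<le> \<phi> t * \<bar>K\<bar>" using pos by (intro mult_left_mono) auto
      then show ?case using pos by (simp add: abs_mult mult.commute)
    qed
  qed
  have iU: "integrable ?M (\<lambda>t. \<phi> t *\<^sub>R U t)"
  proof (rule Bochner_Integration.integrable_bound[OF integrable_mult_right[OF iphi, of a]])
    show "(\<lambda>t. \<phi> t *\<^sub>R U t) \<in> borel_measurable ?M"
      by (intro borel_measurable_scaleR mphi borel_measurable_lebesgue_on_Ioo[OF cU])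
    show "AE t in ?M. norm (\<phi> t *\<^sub>R U t) \<le> norm (a * \<phi> t)"
      by (auto simp: U_def abs_mult)
  qed
  \<comment> \<open>The inward unit vector at time \<open>m\<close>.\<close>
  define w where "w = - direction (\<theta> + \<sigma> * a * m)"
  have "norm w = 1" by (simp add: w_def)
  have "a * cos (a * \<delta>) * (LINT t|?M. \<phi> t) = (LINT t|?M. a * cos (a * \<delta>) * \<phi> t)" by simp
  also have "\<dots> \<le> (LINT t|?M. (\<phi> t *\<^sub>R U t) \<bullet> w)"
  proof (intro integral_mono integrable_mult_right iphi integrable_inner_left iU)
    fix t
    show "a * cos (a * \<delta>) * \<phi> t \<le> (\<phi> t *\<^sub>R U t) \<bullet> w"
    proof (cases "t \<in> {m - \<delta>..m + \<delta>}")
      case True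
      have "\<theta> + \<sigma> * a * (t - 0) - (\<theta> + \<sigma> * a * m) = \<sigma> * (a * (t - m))"
        by (simp add: algebra_simps)
      then have "U t \<bullet> w = a * cos (\<sigma> * (a * (t - m)))"
        by (simp add: U_def w_def inner_direction)
      also have "cos (\<sigma> * (a * (t - m))) = cos (a * \<bar>t - m\<bar>)"
        using \<sigma> a cos_abs_real[of "a * (t - m)"] by (auto simp: abs_mult)
      finally have "U t \<bullet> w = a * cos (a * \<bar>t - m\<bar>)" .
      moreover have "cos (a * \<delta>) \<le> cos (a * \<bar>t - m\<bar>)"
        using True a \<delta>(4) by (intro cos_monotone_0_pi_le) (auto simp: field_simps)
      ultimately have "a * cos (a * \<delta>) \<le> U t \<bullet> w" using a by simp
      then show ?thesis using pos(1)[of t] by (simp add: mult.commute[of _ "\<phi> t"] mult_left_mono)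
    qed (use supp in auto)
  qed
  also have "\<dots> = (LINT t|?M. (\<phi> t *\<^sub>R u t) \<bullet> w)"
    by (simp only: integral_inner_left[OF iu] integral_inner_left[OF iU] eq)
  also have "\<dots> \<le> (LINT t|?M. K * \<phi> t)"
  proof (intro integral_mono_AE integrable_mult_right iphi integrable_inner_left iu)
    show "AE t in ?M. (\<phi> t *\<^sub>R u t) \<bullet> w \<le> K * \<phi> t"
      using bound
    proof eventually_elim
      case (elim t)
      have "u t \<bullet> w \<le> K"
        using norm_cauchy_schwarz[of "u t" w] elim \<open>norm w = 1\<close> by simp
      then show ?case using pos(1)[of t] by (simp add: mult.commute[of K] mult_left_mono)
    qed
  qed
  also have "\<dots> = K * (LINT t|?M. \<phi> t)" by simp
  finally have "(a * cos (a * \<delta>) - K) * (LINT t|?M. \<phi> t) \<le> 0" by (simp add: algebra_simps)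
  then have "(LINT t|?M. \<phi> t) \<le> 0" using \<delta>(1) by (simp add: mult_le_0_iff)
  moreover have "0 \<le> (LINT t|?M. \<phi> t)" using pos by (intro integral_nonneg_AE) auto
  ultimately have "(LINT t|?M. \<phi> t) = 0" by simp
  then have "(\<phi> has_integral 0) {0..T}"
    using has_integral_integral_lebesgue_on[OF iphi] by (simp add: has_integral_Icc_iff_Ioo)
  then have "\<phi> m = 0"
    using has_integral_0_cbox_imp_0[of 0 T \<phi> m] c0 pos d by (auto simp: m_def)
  then show False using pos by simp
qed

section \<open>A turning angle with a prescribed chord\<close>

lemma has_integral_cos_affine:
  fixes p c x y :: real
  assumes "c \<noteq> 0" "x \<le> y"
  shows "((\<lambda>s. cos (p + c * s)) has_integral (sin (p + c * y) - sin (p + c * x)) / c) {x..y}"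
proof -
  have "((\<lambda>s. cos (p + c * s)) has_integral (sin (p + c * y) / c - sin (p + c * x) / c)) {x..y}"
    using assms
    by (intro fundamental_theorem_of_calculus)
       (auto intro!: derivative_eq_intros simp flip: has_real_derivative_iff_has_vector_derivative)
  then show ?thesis by (simp add: diff_divide_distrib)
qed

text \<open>The two extreme shapes: with slope \<open>-b / h\<close> the angle falls linearly to \<open>0\<close>, with slope \<open>K\<close> it rises to
the peak \<open>(b + K * h) / 2\<close> first.\<close>

lemma integral_cos_falling:
  fixes b h K :: real
  assumes "0 < b" "0 < h" "b \<le> K * h"
  shows "((\<lambda>s. cos (min (b + (- b / h) * s) (K * (h - s)))) has_integral h * sin b / b) {0..h}"
proof -
  have "((\<lambda>s. cos (b + (- b / h) * s)) has_integral (sin (b + (- b / h) * h) - sin (b + (- b / h) * 0)) / (- b / h)) {0..h}"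
    using assms by (intro has_integral_cos_affine) auto
  moreover have "min (b + (- b / h) * s) (K * (h - s)) = b + (- b / h) * s" if "s \<in> {0..h}" for s
  proof -
    have "b / h * (h - s) \<le> K * (h - s)"
      using assms that by (intro mult_right_mono) (auto simp: field_simps)
    moreover have "b + (- b / h) * s = b / h * (h - s)" using assms by (simp add: field_simps)
    ultimately show ?thesis by simp
  qed
  ultimately have "((\<lambda>s. cos (min (b + (- b / h) * s) (K * (h - s)))) has_integral
      (sin (b + (- b / h) * h) - sin (b + (- b / h) * 0)) / (- b / h)) {0..h}"
    by (subst has_integral_cong) auto
  then show ?thesis using assms by (simp add: mult.commute)
qed

lemma integral_cos_peak:
  fixes b h K :: real
  assumes "0 < b" "0 < h" "0 < K" "b < K * h"
  shows "((\<lambda>s. cos (min (b + K * s) (K * (h - s)))) has_integral (2 * sin ((b + K * h) / 2) - sin b) / K) {0..h}"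
proof -
  define x where "x = (K * h - b) / (2 * K)"
  have x: "0 \<le> x" "x \<le> h" and Kx: "K * x = (K * h - b) / 2"
    using assms by (auto simp: x_def field_simps)
  have "((\<lambda>s. cos (b + K * s)) has_integral (sin (b + K * x) - sin (b + K * 0)) / K) {0..x}"
    using assms x by (intro has_integral_cos_affine) auto
  then have 1: "((\<lambda>s. cos (min (b + K * s) (K * (h - s)))) has_integral (sin (b + K * x) - sin (b + K * 0)) / K) {0..x}"
  proof (rule has_integral_eq[rotated])
    fix s assume "s \<in> {0..x}"
    then have "K * s \<le> K * x" using assms by simp
    then have "b + K * s \<le> K * (h - s)" using Kx by (simp add: algebra_simps)
    then show "cos (b + K * s) = cos (min (b + K * s) (K * (h - s)))" by (simp add: min_def)
  qed
  have "((\<lambda>s. cos (K * h + (- K) * s)) has_integral (sin (K * h + (- K) * h) - sin (K * h + (- K) * x)) / (- K)) {x..h}"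
    using assms x by (intro has_integral_cos_affine) auto
  then have 2: "((\<lambda>s. cos (min (b + K * s) (K * (h - s)))) has_integral (sin (K * h + (- K) * h) - sin (K * h + (- K) * x)) / (- K)) {x..h}"
  proof (rule has_integral_eq[rotated])
    fix s assume "s \<in> {x..h}"
    then have "K * x \<le> K * s" using assms by simp
    then have "K * (h - s) \<le> b + K * s" using Kx by (simp add: algebra_simps)
    then show "cos (K * h + (- K) * s) = cos (min (b + K * s) (K * (h - s)))"
      by (simp add: min_absorb2 algebra_simps)
  qed
  have "b + K * x = (b + K * h) / 2" "K * h + (- K) * x = (b + K * h) / 2"
    using Kx by (simp_all add: field_simps)
  then have "(sin (b + K * x) - sin (b + K * 0)) / K + (sin (K * h + (- K) * h) - sin (K * h + (- K) * x)) / (- K)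
      = (2 * sin ((b + K * h) / 2) - sin b) / K"
    by (simp only:) (simp add: diff_divide_distrib)
  with has_integral_combine[OF x 1 2] show ?thesis by simp
qed

text \<open>The value \<open>sin b / a\<close> lies between the integrals of the two extreme shapes. For the linear descent
this holds since \<open>h \<ge> b / a\<close>. For the peak it holds at \<open>K = a\<close>, where the peak is \<open>b + \<pi> / 2\<close> and the
integral is \<open>(2 * cos b - sin b) / a < sin b / a\<close>; by continuity it persists for \<open>K\<close> slightly
below \<open>a\<close>.\<close>

lemma slopes_for_prescribed_chord:
  fixes a b h :: real
  assumes a: "0 < a" and b: "pi / 4 < b" "b < pi" and h: "h = (b + pi) / a"
  obtains j K where "0 < K" "K < a" "- b / h \<le> j" "j \<le> K" "b < K * h"
    "((\<lambda>s. cos (min (b + j * s) (K * (h - s)))) has_integral sin b / a) {0..h}"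
proof -
  have b0: "0 < b" using b(1) pi_gt_zero by linarith
  have h0: "0 < h" unfolding h using a b0 pi_gt_zero by (intro divide_pos_pos add_pos_pos)
  have sb: "0 < sin b" using b b0 by (simp add: sin_gt_zero)
  have cs: "cos b < sin b"
  proof -
    have "sin (b - pi / 4) > 0" using b by (intro sin_gt_zero) auto
    moreover have "sin (b - pi / 4) = (sin b - cos b) * (sqrt 2 / 2)"
      by (simp add: sin_diff sin_45 cos_45 algebra_simps)
    ultimately show ?thesis by (simp add: zero_less_mult_iff)
  qed
  define G where "G K = (2 * sin ((b + K * h) / 2) - sin b) / K" for K
  have "isCont G a" unfolding G_def using a by (intro continuous_intros) auto
  then have lim: "(G \<longlongrightarrow> G a) (at_left a)"
    by (auto simp: isCont_def intro: tendsto_mono at_le)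
  have "G a = (2 * cos b - sin b) / a"
  proof -
    have "(b + a * h) / 2 = b + pi / 2" using a by (simp add: h field_simps)
    then show ?thesis by (simp only: G_def sin_add) simp
  qed
  also have "\<dots> < sin b / a" using a cs by (simp add: field_simps)
  finally have "\<forall>\<^sub>F K in at_left a. G K < sin b / a" by (rule order_tendstoD(2)[OF lim])
  moreover have "b / h < a" using a b0 h0 by (simp add: h field_simps)
  then have "\<forall>\<^sub>F K in at_left a. K \<in> {b / h<..<a}" by (rule eventually_at_left_real)
  ultimately have "\<forall>\<^sub>F K in at_left a. G K < sin b / a \<and> K \<in> {b / h<..<a}"
    by (rule eventually_conj)
  then obtain K where G: "G K < sin b / a" and K: "b / h < K" "K < a"
    by (auto dest!: eventually_happens simp: trivial_limit_at_left_real)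
  have K0: "0 < K" using K(1) b0 h0 by (meson divide_pos_pos less_trans)
  have bKh: "b < K * h" using K(1) h0 by (simp add: field_simps)
  \<comment> \<open>With \<open>K\<close> fixed, only the initial slope \<open>j\<close> still varies.\<close>
  define I where "I j = integral {0..h} (\<lambda>s. cos (min (b + j * s) (K * (h - s))))" for j
  have cont: "continuous_on UNIV I"
    unfolding I_def cbox_interval[symmetric] case_prod_beta
    by (rule integral_continuous_on_param) (auto simp: case_prod_beta intro!: continuous_intros)
  have "I K = G K" unfolding I_def G_def
    by (intro integral_unique integral_cos_peak b0 h0 K0 bKh)
  then have IK: "I K \<le> sin b / a" using G by simp
  have "I (- b / h) = h * sin b / b" unfolding I_def
    using bKh by (intro integral_unique integral_cos_falling b0 h0) simp
  moreover have "1 / a \<le> h / b" using a b0 by (simp add: h field_simps)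
  then have "sin b * (1 / a) \<le> sin b * (h / b)" using sb by (intro mult_left_mono) auto
  ultimately have "sin b / a \<le> I (- b / h)" by (simp add: mult.commute)
  moreover have "- b / h \<le> K" using K0 b0 h0 by (smt (verit) divide_neg_pos)
  ultimately obtain j where j: "- b / h \<le> j" "j \<le> K" "I j = sin b / a"
    using IK IVT2'[of I K "sin b / a" "- b / h"] continuous_on_subset[OF cont] by auto
  have "(\<lambda>s. cos (min (b + j * s) (K * (h - s)))) integrable_on {0..h}"
    by (intro integrable_continuous_real continuous_intros)
  then have "((\<lambda>s. cos (min (b + j * s) (K * (h - s)))) has_integral sin b / a) {0..h}"
    using j(3) by (simp add: I_def has_integral_integral)
  with K0 K(2) j(1,2) bKh show thesis by (intro that)
qed

lemma has_integral_mirror: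
  fixes f :: "real \<Rightarrow> real"
  assumes "(f has_integral i) {0..h}"
  shows "((\<lambda>s. f (2 * h - s)) has_integral i) {h..2 * h}"
proof -
  have "(\<lambda>x. 2 * h - x) ` {0..h} = {h..2 * h}"
    by (auto simp: image_iff intro!: bexI[of _ "2 * h - _"])
  then show ?thesis
    using has_integral_affinity[of f i 0 h "-1" "2 * h"] assms by simp
qed

text \<open>The odd continuation of the half profile beyond \<open>h\<close>. Oddness makes the integral of the sine vanish and
doubles that of the cosine.\<close>

lemma competitor_angle:
  fixes a b h :: real
  assumes a: "0 < a" and b: "pi / 4 < b" "b < pi" and h: "h = (b + pi) / a"
  obtains \<Theta> \<kappa> S K where "K < a" "continuous_on UNIV \<Theta>" "\<Theta> 0 = b" "\<Theta> (2 * h) = - b"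
    "finite S" "\<And>t. t \<notin> S \<Longrightarrow> (\<Theta> has_real_derivative \<kappa> t) (at t)"
    "\<kappa> \<in> borel_measurable borel" "\<And>t. \<bar>\<kappa> t\<bar> \<le> K"
    "((\<lambda>t. cos (\<Theta> t)) has_integral 2 * sin b / a) {0..2 * h}"
    "((\<lambda>t. sin (\<Theta> t)) has_integral 0) {0..2 * h}"
proof -
  obtain j K where K: "0 < K" "K < a" "b < K * h" and j: "- b / h \<le> j" "j \<le> K"
    and I: "((\<lambda>s. cos (min (b + j * s) (K * (h - s)))) has_integral sin b / a) {0..h}"
    using slopes_for_prescribed_chord[OF assms] by metis
  have b0: "0 < b" using b(1) pi_gt_zero by linarith
  have h0: "0 < h" unfolding h using a b0 pi_gt_zero by (intro divide_pos_pos add_pos_pos)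
  define c where "c = b + j * h"
  define l where "l = K + j"
  \<comment> \<open>Up to a linear part with slope \<open>j\<close>, the profile is a linear function truncated to \<open>[-c, c]\<close>; this single formula covers both halves.\<close>
  define \<Theta> where "\<Theta> t = j * (t - h) - max (- c) (min c (l * (t - h)))" for t
  define \<kappa> where "\<kappa> t = (if \<bar>l * (t - h)\<bar> < c then - K else j)" for t
  have c0: "0 \<le> c" using j(1) h0 by (simp add: c_def field_simps)
  have jK: "- K < j" using j(1) K(3) h0 b0 by (smt (verit) divide_minus_left pos_divide_less_eq)
  have l0: "0 < l" using jK by (simp add: l_def)
  have lh: "c \<le> l * h" using K(3) by (simp add: c_def l_def algebra_simps)
  have cont: "continuous_on UNIV \<Theta>" unfolding \<Theta>_def by (intro continuous_intros)
  have odd: "\<Theta> (2 * h - t) = - \<Theta> t" for t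
  proof -
    have "l * (2 * h - t - h) = - (l * (t - h))" by (simp add: algebra_simps)
    then have "max (- c) (min c (l * (2 * h - t - h))) = - max (- c) (min c (l * (t - h)))"
      using c0 by (auto simp: max_def min_def)
    then show ?thesis by (simp add: \<Theta>_def algebra_simps)
  qed
  have first_half: "\<Theta> t = min (b + j * t) (K * (h - t))" if "t \<le> h" for t
  proof -
    have "l * (t - h) \<le> 0" using l0 that by (simp add: mult_le_0_iff)
    then have "max (- c) (min c (l * (t - h))) = - min c (l * (h - t))"
      using c0 by (auto simp: max_def min_def algebra_simps)
    then show ?thesis by (auto simp: \<Theta>_def c_def l_def min_def algebra_simps)
  qed
  have T0: "\<Theta> 0 = b" using h0 K(3) by (simp add: first_half)
  have T2: "\<Theta> (2 * h) = - b" using odd[of 0] T0 by simp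
  have der: "(\<Theta> has_real_derivative \<kappa> t) (at t)" if "t \<notin> {h - c / l, h + c / l}" for t
  proof -
    have kink: "l * (t - h) \<noteq> c" "l * (t - h) \<noteq> - c" using that l0 by (auto simp: field_simps)
    consider "l * (t - h) < - c" | "\<bar>l * (t - h)\<bar> < c" | "c < l * (t - h)"
      using kink by linarith
    then show ?thesis
    proof cases
      case 1
      have op: "open {s. l * (s - h) < - c}" by (intro open_Collect_less continuous_intros)
      have "((\<lambda>s. j * (s - h) + c) has_real_derivative j) (at t)"
        by (auto intro!: derivative_eq_intros)
      then have "(\<Theta> has_real_derivative j) (at t)"
        by (rule has_field_derivative_transform_within_open[OF _ op])
           (use 1 c0 in \<open>auto simp: \<Theta>_def max_def min_def\<close>)
      then show ?thesis using 1 c0 by (auto simp: \<kappa>_def)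
    next
      case 2
      have op: "open {s. \<bar>l * (s - h)\<bar> < c}" by (intro open_Collect_less continuous_intros)
      have "((\<lambda>s. j * (s - h) - l * (s - h)) has_real_derivative - K) (at t)"
        by (auto intro!: derivative_eq_intros simp: l_def)
      then have "(\<Theta> has_real_derivative - K) (at t)"
        by (rule has_field_derivative_transform_within_open[OF _ op])
           (use 2 c0 in \<open>auto simp: \<Theta>_def max_def min_def\<close>)
      then show ?thesis using 2 by (auto simp: \<kappa>_def)
    next
      case 3
      have op: "open {s. c < l * (s - h)}" by (intro open_Collect_less continuous_intros)
      have "((\<lambda>s. j * (s - h) - c) has_real_derivative j) (at t)"
        by (auto intro!: derivative_eq_intros)
      then have "(\<Theta> has_real_derivative j) (at t)"
        by (rule has_field_derivative_transform_within_open[OF _ op])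
           (use 3 c0 in \<open>auto simp: \<Theta>_def max_def min_def\<close>)
      then show ?thesis using 3 c0 by (auto simp: \<kappa>_def)
    qed
  qed
  have meas: "\<kappa> \<in> borel_measurable borel" unfolding \<kappa>_def by measurable
  have bound: "\<bar>\<kappa> t\<bar> \<le> K" for t using K(1) j(2) jK by (auto simp: \<kappa>_def)
  have c1: "((\<lambda>t. cos (\<Theta> t)) has_integral sin b / a) {0..h}"
    by (rule has_integral_eq[OF _ I]) (simp add: first_half)
  have c2: "((\<lambda>t. cos (\<Theta> t)) has_integral sin b / a) {h..2 * h}"
    using has_integral_mirror[OF c1] by (simp add: odd)
  have C: "((\<lambda>t. cos (\<Theta> t)) has_integral 2 * sin b / a) {0..2 * h}"
    using has_integral_combine[OF _ _ c1 c2] h0 by simp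
  have "(\<lambda>t. sin (\<Theta> t)) integrable_on {0..h}"
    by (intro integrable_continuous_real continuous_intros continuous_on_subset[OF cont]) auto
  then obtain i where s1: "((\<lambda>t. sin (\<Theta> t)) has_integral i) {0..h}" by blast
  have s2: "((\<lambda>t. sin (\<Theta> t)) has_integral - i) {h..2 * h}"
    using has_integral_neg[OF has_integral_mirror[OF s1]] by (simp add: odd)
  have S: "((\<lambda>t. sin (\<Theta> t)) has_integral 0) {0..2 * h}"
    using has_integral_combine[OF _ _ s1 s2] h0 by simp
  show thesis
    using that[where S = "{h - c / l, h + c / l}", OF K(2) cont T0 T2 _ der meas bound C S] by simp
qed

section \<open>The competitor\<close>

text \<open>The curve whose velocity makes the angle \<open>\<Theta>\<close> with the chord. The frame is taken at the middle \<open>\<mu>\<close> of the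
arc: \<open>normal \<mu>\<close> is parallel to the chord, so the integral of \<open>cos \<Theta>\<close> gives the displacement along the
chord and the integral of \<open>sin \<Theta>\<close> the displacement across it.\<close>

lemma admissible_competitor:
  fixes a b T \<theta> \<sigma> :: real and c :: "real^2"
  assumes a: "0 < a" and b: "pi / 4 < b" "b < pi" and \<sigma>: "\<sigma> = 1 \<or> \<sigma> = -1"
    and T: "T = 2 * ((b + pi) / a)"
  obtains K z v u where "K < a"
    "admissible (c + (1 / a) *\<^sub>R direction \<theta>) (c + (1 / a) *\<^sub>R direction (\<theta> + \<sigma> * (2 * b)))
       (\<sigma> *\<^sub>R normal \<theta>) (\<sigma> *\<^sub>R normal (\<theta> + \<sigma> * (2 * b))) T z v u"
    "ess_sup_norm {0<..<T} u \<le> ereal K"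
proof -
  obtain \<Theta> \<kappa> S K where K: "K < a" and cont: "continuous_on UNIV \<Theta>"
    and ends: "\<Theta> 0 = b" "\<Theta> T = - b" and S: "finite S"
    and der: "\<And>t. t \<notin> S \<Longrightarrow> (\<Theta> has_real_derivative \<kappa> t) (at t)"
    and meas: "\<kappa> \<in> borel_measurable borel" and bound: "\<And>t. \<bar>\<kappa> t\<bar> \<le> K"
    and C: "((\<lambda>t. cos (\<Theta> t)) has_integral 2 * sin b / a) {0..T}"
    and I: "((\<lambda>t. sin (\<Theta> t)) has_integral 0) {0..T}"
    using competitor_angle[OF a b refl] unfolding T by metis
  have T0: "0 < T" using a b pi_gt_zero unfolding T by (simp add: field_simps)
  define \<mu> where "\<mu> = \<theta> + \<sigma> * b"
  define v where "v t = \<sigma> *\<^sub>R normal (\<mu> + - \<sigma> * \<Theta> t)" for t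
  define u where "u t = \<kappa> t *\<^sub>R direction (\<mu> + - \<sigma> * \<Theta> t)" for t
  define z where "z t = c + (1 / a) *\<^sub>R direction \<theta> + integral {0..t} v" for t
  let ?I = "{0<..<T}"
  have cv: "continuous_on A v" and cd: "continuous_on A (\<lambda>t. direction (\<mu> + - \<sigma> * \<Theta> t))" for A
    unfolding v_def
    by (intro continuous_intros continuous_on_direction continuous_on_normal continuous_on_subset[OF cont]; simp)+
  have nv: "norm (v t) = 1" for t using \<sigma> by (auto simp: v_def)
  have nu: "norm (u t) \<le> K" for t using bound by (simp add: u_def)
  have dz: "(z has_vector_derivative v t) (at t within {0..T})" if "t \<in> {0..T}" for t
    unfolding z_def using integral_has_vector_derivative[OF cv that]
    by (auto intro!: derivative_eq_intros)
  have dv: "(v has_vector_derivative u t) (at t)" if "t \<notin> S" for t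
  proof -
    have "((\<lambda>t. \<mu> + - \<sigma> * \<Theta> t) has_real_derivative - \<sigma> * \<kappa> t) (at t)"
      by (auto intro!: derivative_eq_intros der[OF that])
    from normal_vector_derivative[OF this] show ?thesis
      unfolding v_def u_def using \<sigma> by (auto intro!: derivative_eq_intros)
  qed
  have cz: "continuous_on {0..T} z"
    using dz by (meson continuous_on_eq_continuous_within has_vector_derivative_continuous)
  have mv: "v \<in> borel_measurable (lebesgue_on ?I)" and mz: "z \<in> borel_measurable (lebesgue_on ?I)"
    by (rule borel_measurable_lebesgue_on_Ioo[OF cv] borel_measurable_lebesgue_on_Ioo[OF cz])+
  have mk: "\<kappa> \<in> borel_measurable (lebesgue_on ?I)"
    by (intro measurable_restrict_space1 measurable_completion) (use meas in simp)
  have mu: "u \<in> borel_measurable (lebesgue_on ?I)"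
    unfolding u_def by (intro borel_measurable_scaleR mk borel_measurable_lebesgue_on_Ioo[OF cd])
  obtain B where B: "\<And>t. t \<in> {0..T} \<Longrightarrow> norm (z t) \<le> B" using continuous_on_Icc_bounded[OF cz] by blast
  have "W2inf_curve T z v u"
    unfolding W2inf_curve_def
  proof (intro conjI cz cv)
    show "z \<in> Linf ?I" by (rule Linf_of_bounded[OF mz, of B]) (use B in auto)
    show "v \<in> Linf ?I" by (rule Linf_of_bounded[OF mv, of 1]) (simp add: nv)
    show "u \<in> Linf ?I" by (rule Linf_of_bounded[OF mu, of K]) (rule nu)
    show "weak_derivative ?I z v"
    proof (rule weak_derivative_of_piecewise[OF T0 cz finite.emptyI _ mv, of 1])
      show "(z has_vector_derivative v t) (at t)" if "t \<in> ?I - {}" for t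
        using dz[of t] that by (simp add: at_within_Icc_at)
    qed (simp add: nv)
    show "weak_derivative ?I v u"
      by (rule weak_derivative_of_piecewise[OF T0 cv S _ mu, of K]) (auto intro: dv nu)
  qed
  moreover have "z T = c + (1 / a) *\<^sub>R direction (\<theta> + \<sigma> * (2 * b))"
  proof -
    have v_eq: "v t = cos (\<Theta> t) *\<^sub>R (\<sigma> *\<^sub>R normal \<mu>) + sin (\<Theta> t) *\<^sub>R direction \<mu>" for t
      using \<sigma> normal_add[of \<mu> "\<Theta> t"] normal_add[of \<mu> "- \<Theta> t"] by (auto simp: v_def)
    have "(v has_integral ((2 * sin b / a) *\<^sub>R (\<sigma> *\<^sub>R normal \<mu>) + 0 *\<^sub>R direction \<mu>)) {0..T}"
      unfolding v_eq by (intro has_integral_add has_integral_scaleR_left C I)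
    then have iv: "integral {0..T} v = (2 * sin b / a) *\<^sub>R (\<sigma> *\<^sub>R normal \<mu>)"
      by (simp add: integral_unique)
    have "direction \<theta> = direction (\<mu> + - \<sigma> * b)" "direction (\<theta> + \<sigma> * (2 * b)) = direction (\<mu> + \<sigma> * b)"
      by (simp_all add: \<mu>_def algebra_simps)
    moreover have "direction (\<mu> + \<sigma> * b) = direction (\<mu> + - \<sigma> * b) + (2 * sin b * \<sigma>) *\<^sub>R normal \<mu>"
      unfolding direction_add using \<sigma> by (auto simp: vec_eq_iff algebra_simps)
    ultimately have "direction (\<theta> + \<sigma> * (2 * b)) = direction \<theta> + (2 * sin b * \<sigma>) *\<^sub>R normal \<mu>"
      by simp
    then show ?thesis by (simp add: z_def iv algebra_simps)
  qed
  moreover have "z 0 = c + (1 / a) *\<^sub>R direction \<theta>" by (simp add: z_def)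
  moreover have "v 0 = \<sigma> *\<^sub>R normal \<theta>" "v T = \<sigma> *\<^sub>R normal (\<theta> + \<sigma> * (2 * b))"
    by (simp_all add: v_def ends \<mu>_def algebra_simps)
  ultimately have "admissible (c + (1 / a) *\<^sub>R direction \<theta>) (c + (1 / a) *\<^sub>R direction (\<theta> + \<sigma> * (2 * b)))
       (\<sigma> *\<^sub>R normal \<theta>) (\<sigma> *\<^sub>R normal (\<theta> + \<sigma> * (2 * b))) T z v u"
    by (simp add: admissible_def nv)
  moreover have "ess_sup_norm ?I u \<le> ereal K"
    by (subst ess_sup_norm_le_iff[OF mu]) (simp add: nu)
  ultimately show thesis using that K by blast
qed


section \<open>Non-optimality of long arcs\<close>

lemma velocity_on_circle:
  fixes z :: "real \<Rightarrow> real^2"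
  assumes "a > 0" "s < t" "x \<in> {s..t}" "{s..t} \<subseteq> D"
    and "(z has_vector_derivative w) (at x within D)"
    and "\<And>\<tau>. \<tau> \<in> {s..t} \<Longrightarrow> z \<tau> = c + (1 / a) *\<^sub>R direction (\<theta> + \<sigma> * a * (\<tau> - \<rho>))"
  shows "w = \<sigma> *\<^sub>R normal (\<theta> + \<sigma> * a * (x - \<rho>))"
proof (rule vector_derivative_unique_within)
  show "at x within {s..t} \<noteq> bot"
    using assms(2,3) by (simp add: trivial_limit_within islimpt_Icc)
  show "(z has_vector_derivative w) (at x within {s..t})"
    using assms(5,4) by (rule has_vector_derivative_within_subset)
  show "(z has_vector_derivative \<sigma> *\<^sub>R normal (\<theta> + \<sigma> * a * (x - \<rho>))) (at x within {s..t})"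
    by (rule has_vector_derivative_transform[OF assms(3) _ circle_vector_derivative[OF assms(1)]])
       (simp add: assms(6))
qed

theorem proposition24:
  fixes a \<beta> tf t1 t2 \<sigma>1 \<sigma>2 \<sigma>3 :: real
    and c1 c2 c3 :: "real^2"
    and z v :: "real \<Rightarrow> real^2"
  assumes "a > 0"
    and "COC_path (1 / a) tf z v t1 t2 \<sigma>1 c1 \<sigma>2 c2 \<sigma>3 c3"
    and "\<sigma>1 = \<sigma>3" and "c1 = c3"
    and "C_piece (1 / a) \<sigma>1 c1 \<beta> (remove_loop t1 t2 z) 0 (tf - (t2 - t1))"
    and "tf = (\<beta> + 2 * pi) / a"
    and "solves_P (z 0) (z tf) (v 0) (v tf) tf z"
  shows "\<beta> \<le> pi / 2"
proof (rule ccontr)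
  assume "\<not> \<beta> \<le> pi / 2"
  note a = \<open>a > 0\<close> and COC = assms(2)[unfolded COC_path_def C_piece_def O_piece_def circular_piece_def]
    and arc = assms(5)[unfolded C_piece_def circular_piece_def]
  have t: "0 < t1" "t1 < t2" "t2 < tf" using COC by blast+
  have \<sigma>: "\<sigma>1 = 1 \<or> \<sigma>1 = -1" and \<beta>: "\<beta> < 2 * pi" using arc by blast+
  have loop: "t2 - t1 = 2 * pi / a" using COC a by (auto simp: field_simps)
  have tf: "tf - (t2 - t1) = \<beta> / a" using assms(6) loop by (simp add: add_divide_distrib)
  obtain \<theta> where \<theta>: "\<forall>\<tau>\<in>{0..tf - (t2 - t1)}. remove_loop t1 t2 z \<tau> =
      c1 + (1 / a) *\<^sub>R vector [cos (\<theta> + \<sigma>1 * (\<tau> - 0) / (1 / a)), sin (\<theta> + \<sigma>1 * (\<tau> - 0) / (1 / a))]"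
    using arc by blast
  then have rl: "remove_loop t1 t2 z \<tau> = c1 + (1 / a) *\<^sub>R direction (\<theta> + \<sigma>1 * a * \<tau>)"
    if "\<tau> \<in> {0..tf - (t2 - t1)}" for \<tau>
    using that by (simp add: direction_def mult.commute mult.left_commute)
  have start: "z \<tau> = c1 + (1 / a) *\<^sub>R direction (\<theta> + \<sigma>1 * a * \<tau>)" if "\<tau> \<in> {0..t1}" for \<tau>
    using rl[of \<tau>] that t by (simp add: remove_loop_def)
  \<comment> \<open>At \<open>t2\<close> itself the path without its loop is still described by the time \<open>t1\<close>, so only an interval beginning after \<open>t2\<close> is used.\<close>
  have finish: "z \<tau> = c1 + (1 / a) *\<^sub>R direction (\<theta> + \<sigma>1 * a * (\<tau> - (t2 - t1)))"
    if "\<tau> \<in> {(t2 + tf) / 2..tf}" for \<tau>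
    using rl[of "\<tau> - (t2 - t1)"] that t by (simp add: remove_loop_def)
  have vel: "(z has_vector_derivative v \<tau>) (at \<tau> within {0..tf})" if "\<tau> \<in> {0..tf}" for \<tau>
    using COC that by (auto simp: unit_speed_C1_def)
  have aT: "\<sigma>1 * a * (tf - (t2 - t1)) = \<sigma>1 * \<beta>" using tf a by simp
  have ends: "z 0 = c1 + (1 / a) *\<^sub>R direction \<theta>" "z tf = c1 + (1 / a) *\<^sub>R direction (\<theta> + \<sigma>1 * (2 * (\<beta> / 2)))"
    using start[of 0] finish[of tf] t aT by auto
  have "v 0 = \<sigma>1 *\<^sub>R normal (\<theta> + \<sigma>1 * a * (0 - 0))"
  proof (rule velocity_on_circle[OF a t(1) _ _ vel[of 0]])
    show "z \<tau> = c1 + (1 / a) *\<^sub>R direction (\<theta> + \<sigma>1 * a * (\<tau> - 0))" if "\<tau> \<in> {0..t1}" for \<tau>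
      using start[OF that] by simp
  qed (use t in auto)
  moreover have "v tf = \<sigma>1 *\<^sub>R normal (\<theta> + \<sigma>1 * a * (tf - (t2 - t1)))"
    by (rule velocity_on_circle[where s = "(t2 + tf) / 2", OF a _ _ _ vel finish]) (use t in auto)
  ultimately have vends: "v 0 = \<sigma>1 *\<^sub>R normal \<theta>" "v tf = \<sigma>1 *\<^sub>R normal (\<theta> + \<sigma>1 * (2 * (\<beta> / 2)))"
    using aT by simp_all
  have "(\<beta> + 2 * pi) / a = 2 * ((\<beta> / 2 + pi) / a)"
    by (simp add: add_divide_distrib distrib_left)
  then have "pi / 4 < \<beta> / 2" "\<beta> / 2 < pi" "tf = 2 * ((\<beta> / 2 + pi) / a)"
    using \<open>\<not> \<beta> \<le> pi / 2\<close> \<beta> assms(6) by auto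
  from admissible_competitor[OF a this(1,2) \<sigma> this(3), of c1 \<theta>, folded ends vends]
  obtain K z' v' u' where K: "K < a" and "admissible (z 0) (z tf) (v 0) (v tf) tf z' v' u'"
    and "ess_sup_norm {0<..<tf} u' \<le> ereal K" by metis
  moreover obtain w u where "admissible (z 0) (z tf) (v 0) (v tf) tf z w u"
    and "\<And>z' v' u'. admissible (z 0) (z tf) (v 0) (v tf) tf z' v' u' \<Longrightarrow>
      ess_sup_norm {0<..<tf} u \<le> ess_sup_norm {0<..<tf} u'"
    using assms(7) unfolding solves_P_def by blast
  ultimately have W: "W2inf_curve tf z w u" and "ess_sup_norm {0<..<tf} u \<le> ereal K"
    unfolding admissible_def by (auto intro: order_trans)
  then have "AE t in lebesgue_on {0<..<tf}. norm (u t) \<le> K"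
    by (subst (asm) ess_sup_norm_le_iff) (auto simp: W2inf_curve_def Linf_def)
  then have "a \<le> K"
    using curvature_bound_of_circular_start[OF W a \<sigma> t(1) _ start] t by auto
  then show False using K by simp
qed

end
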